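(* Let $\phi(w)=aw+b$ with $a>0$ and $\mathrm{Re}(b)\geq 0$ be any affine self-map of the open right half-plane $\mathbb{C}_+$. Then the composition operator $C_\phi$ is not hypercyclic on $H^2(\mathbb{C}_+)$.
   Context: $\mathbb{C}_+=\{w\in\mathbb{C}:\mathrm{Re}(w)>0\}$. The Hardy space $H^2(\mathbb{C}_+)$ is the Hilbert space of analytic functions $f$ on $\mathbb{C}_+$ for which $\|f\|_2^2=\sup_{0<x<\infty}\int_{-\infty}^{\infty}|f(x+iy)|^2\,dy$ is finite. For a holomorphic self-map $\phi$ of $\mathbb{C}_+$, the composition operator is $C_\phi f=f\circ\phi$; for $\phi(w)=aw+b$ with $a>0$ and $\mathrm{Re}(b)\ge 0$ it is a bounded operator on $H^2(\mathbb{C}_+)$. An operator $T$ on a separable Hilbert space $\mathcal{H}$ is hypercyclic if there is $f\in\mathcal{H}$ such that the orbit $\{T^nf:n\ge 0\}$ is dense in $\mathcal{H}$. *)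

theory Defs
  imports "HOL-Complex_Analysis.Complex_Analysis"
begin

definition right_half_plane :: "complex set" ("\<complex>\<^sub>+")
  where "\<complex>\<^sub>+ = {w. Re w > 0}"

text \<open>The integrals are Lebesgue integrals with values in the extended nonnegative reals, so the
  supremum always exists and membership in the Hardy space is its finiteness.\<close>

definition hardy2_norm_sq :: "(complex \<Rightarrow> complex) \<Rightarrow> ennreal"
  where "hardy2_norm_sq f =
    (SUP x\<in>{0<..}. \<integral>\<^sup>+ y. ennreal ((cmod (f (Complex x y)))\<^sup>2) \<partial>lborel)"

definition hardy2_norm :: "(complex \<Rightarrow> complex) \<Rightarrow> real"
  where "hardy2_norm f = sqrt (enn2real (hardy2_norm_sq f))"

text \<open>A function on the half-plane is represented by the total function that is \<open>undefined\<close>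
  outside it, so that equality in the Hardy space is equality of functions.\<close>

definition hardy2 :: "(complex \<Rightarrow> complex) set"
  where "hardy2 =
    {f \<in> extensional \<complex>\<^sub>+. f holomorphic_on \<complex>\<^sub>+ \<and> hardy2_norm_sq f < \<infinity>}"

definition hardy2_dist :: "(complex \<Rightarrow> complex) \<Rightarrow> (complex \<Rightarrow> complex) \<Rightarrow> real"
  where "hardy2_dist f g = hardy2_norm (\<lambda>w. f w - g w)"

definition hardy2_topology :: "(complex \<Rightarrow> complex) topology"
  where "hardy2_topology = Metric_space.mtopology hardy2 hardy2_dist"

definition composition_operator ::
    "(complex \<Rightarrow> complex) \<Rightarrow> (complex \<Rightarrow> complex) \<Rightarrow> (complex \<Rightarrow> complex)"
  where "composition_operator \<phi> f = restrict (f \<circ> \<phi>) \<complex>\<^sub>+"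

definition hypercyclic :: "'a topology \<Rightarrow> ('a \<Rightarrow> 'a) \<Rightarrow> bool"
  where "hypercyclic X T \<longleftrightarrow>
    (\<exists>f\<in>topspace X. X closure_of (range (\<lambda>n. (T ^^ n) f)) = topspace X)"


text \<open>The distance is a metric on the Hardy space, so the topology above is the norm topology.\<close>

lemma open_right_half_plane: "open \<complex>\<^sub>+"
  by (simp add: right_half_plane_def open_halfspace_Re_gt)

lemma hardy2_line_measurable:
  assumes "f holomorphic_on \<complex>\<^sub>+" "x > 0"
  shows "continuous_on UNIV (\<lambda>y. f (Complex x y))"
    and "(\<lambda>y. f (Complex x y)) \<in> borel_measurable lborel"
proof -
  have "continuous_on UNIV (\<lambda>y. Complex x y)"
    by (simp add: Complex_eq continuous_intros)
  moreover have "continuous_on \<complex>\<^sub>+ f"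
    using assms(1) by (rule holomorphic_on_imp_continuous_on)
  moreover have "range (\<lambda>y. Complex x y) \<subseteq> \<complex>\<^sub>+"
    using assms(2) by (auto simp: right_half_plane_def)
  ultimately show c: "continuous_on UNIV (\<lambda>y. f (Complex x y))"
    using continuous_on_compose2 by blast
  show "(\<lambda>y. f (Complex x y)) \<in> borel_measurable lborel"
    using borel_measurable_continuous_onI[OF c] by simp
qed

lemma hardy2_line_le:
  assumes "x > 0"
  shows "(\<integral>\<^sup>+ y. ennreal ((cmod (f (Complex x y)))\<^sup>2) \<partial>lborel) \<le> hardy2_norm_sq f"
  unfolding hardy2_norm_sq_def using assms by (intro SUP_upper) auto

lemma hardy2_norm_sq_add_le:
  assumes f: "f holomorphic_on \<complex>\<^sub>+" and g: "g holomorphic_on \<complex>\<^sub>+" and t: "t > 0"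
  shows "hardy2_norm_sq (\<lambda>w. f w + g w)
    \<le> ennreal (1 + t) * hardy2_norm_sq f + ennreal (1 + 1 / t) * hardy2_norm_sq g"
  unfolding hardy2_norm_sq_def[of "\<lambda>w. f w + g w"]
proof (rule SUP_least)
  fix x :: real assume "x \<in> {0<..}"
  then have x: "x > 0" by simp
  note [measurable] = hardy2_line_measurable(2)[OF f x] hardy2_line_measurable(2)[OF g x]
  have pw: "ennreal ((cmod (f z + g z))\<^sup>2)
    \<le> ennreal (1 + t) * ennreal ((cmod (f z))\<^sup>2) + ennreal (1 + 1 / t) * ennreal ((cmod (g z))\<^sup>2)" for z
  proof -
    let ?a = "cmod (f z)" and ?b = "cmod (g z)"
    have "(cmod (f z + g z))\<^sup>2 \<le> (?a + ?b)\<^sup>2"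
      by (intro power_mono norm_triangle_ineq norm_ge_zero)
    also have "\<dots> = (1 + t) * ?a\<^sup>2 + (1 + 1 / t) * ?b\<^sup>2 - (t * ?a - ?b)\<^sup>2 / t"
      using t by (simp add: field_simps power2_eq_square)
    also have "\<dots> \<le> (1 + t) * ?a\<^sup>2 + (1 + 1 / t) * ?b\<^sup>2"
      using t by simp
    finally show ?thesis
      using t by (simp flip: ennreal_mult ennreal_plus)
  qed
  have "(\<integral>\<^sup>+ y. ennreal ((cmod (f (Complex x y) + g (Complex x y)))\<^sup>2) \<partial>lborel)
    \<le> (\<integral>\<^sup>+ y. ennreal (1 + t) * ennreal ((cmod (f (Complex x y)))\<^sup>2)
          + ennreal (1 + 1 / t) * ennreal ((cmod (g (Complex x y)))\<^sup>2) \<partial>lborel)"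
    by (intro nn_integral_mono pw)
  also have "\<dots> = ennreal (1 + t) * (\<integral>\<^sup>+ y. ennreal ((cmod (f (Complex x y)))\<^sup>2) \<partial>lborel)
      + ennreal (1 + 1 / t) * (\<integral>\<^sup>+ y. ennreal ((cmod (g (Complex x y)))\<^sup>2) \<partial>lborel)"
    by (simp add: nn_integral_add nn_integral_cmult)
  also have "\<dots> \<le> ennreal (1 + t) * hardy2_norm_sq f + ennreal (1 + 1 / t) * hardy2_norm_sq g"
    by (intro add_mono mult_left_mono hardy2_line_le x) auto
  finally show "(\<integral>\<^sup>+ y. ennreal ((cmod (f (Complex x y) + g (Complex x y)))\<^sup>2) \<partial>lborel)
    \<le> ennreal (1 + t) * hardy2_norm_sq f + ennreal (1 + 1 / t) * hardy2_norm_sq g" .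
qed

lemma hardy2_norm_sq_eq:
  assumes "hardy2_norm_sq f < \<infinity>"
  shows "hardy2_norm_sq f = ennreal ((hardy2_norm f)\<^sup>2)"
  using assms by (simp add: hardy2_norm_def)

lemma hardy2_norm_nonneg: "0 \<le> hardy2_norm f"
  by (simp add: hardy2_norm_def)

lemma hardy2_norm_add:
  assumes f: "f holomorphic_on \<complex>\<^sub>+" "hardy2_norm_sq f < \<infinity>"
    and g: "g holomorphic_on \<complex>\<^sub>+" "hardy2_norm_sq g < \<infinity>"
  shows "hardy2_norm_sq (\<lambda>w. f w + g w) < \<infinity>"
    and "hardy2_norm (\<lambda>w. f w + g w) \<le> hardy2_norm f + hardy2_norm g"
proof -
  let ?F = "hardy2_norm f" and ?G = "hardy2_norm g" and ?H = "hardy2_norm (\<lambda>w. f w + g w)"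
  have le: "hardy2_norm_sq (\<lambda>w. f w + g w) \<le> ennreal ((1 + t) * ?F\<^sup>2 + (1 + 1 / t) * ?G\<^sup>2)"
    if "t > 0" for t
  proof -
    have "hardy2_norm_sq (\<lambda>w. f w + g w)
      \<le> ennreal (1 + t) * ennreal (?F\<^sup>2) + ennreal (1 + 1 / t) * ennreal (?G\<^sup>2)"
      using hardy2_norm_sq_add_le[OF f(1) g(1) that]
      unfolding hardy2_norm_sq_eq[OF f(2)] hardy2_norm_sq_eq[OF g(2)] .
    also have "ennreal (1 + t) * ennreal (?F\<^sup>2) = ennreal ((1 + t) * ?F\<^sup>2)"
      using that by (intro ennreal_mult[symmetric]) auto
    also have "ennreal (1 + 1 / t) * ennreal (?G\<^sup>2) = ennreal ((1 + 1 / t) * ?G\<^sup>2)"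
      using that by (intro ennreal_mult[symmetric]) auto
    also have "ennreal ((1 + t) * ?F\<^sup>2) + ennreal ((1 + 1 / t) * ?G\<^sup>2)
      = ennreal ((1 + t) * ?F\<^sup>2 + (1 + 1 / t) * ?G\<^sup>2)"
      using that by (intro ennreal_plus[symmetric]) auto
    finally show ?thesis .
  qed
  show fin: "hardy2_norm_sq (\<lambda>w. f w + g w) < \<infinity>"
    using le_less_trans[OF le[OF zero_less_one] ennreal_less_top] by simp
  have leR: "?H\<^sup>2 \<le> (1 + t) * ?F\<^sup>2 + (1 + 1 / t) * ?G\<^sup>2" if "t > 0" for t
  proof -
    have "0 \<le> (1 + t) * ?F\<^sup>2 + (1 + 1 / t) * ?G\<^sup>2"
      using that by (intro add_nonneg_nonneg mult_nonneg_nonneg) auto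
    from ennreal_le_iff[OF this] show ?thesis
      using le[OF that] unfolding hardy2_norm_sq_eq[OF fin] by blast
  qed
  have le2: "?H \<le> (?F + e) + (?G + e)" if e: "e > 0" for e
  proof -
    let ?a = "?F + e" and ?b = "?G + e"
    have pos: "?a > 0" "?b > 0" using e hardy2_norm_nonneg[of f] hardy2_norm_nonneg[of g] by auto
    have "?H\<^sup>2 \<le> (1 + ?b / ?a) * ?F\<^sup>2 + (1 + 1 / (?b / ?a)) * ?G\<^sup>2"
      using leR[of "?b / ?a"] pos by simp
    also have "\<dots> \<le> (1 + ?b / ?a) * ?a\<^sup>2 + (1 + 1 / (?b / ?a)) * ?b\<^sup>2"
      using pos e hardy2_norm_nonneg[of f] hardy2_norm_nonneg[of g]
      by (intro add_mono mult_left_mono power_mono) auto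
    also have "\<dots> = (?a + ?b)\<^sup>2"
    proof -
      have "(1 + b / a) * a\<^sup>2 + (1 + 1 / (b / a)) * b\<^sup>2 = (a + b)\<^sup>2" if "a > 0" "b > 0" for a b :: real
        using that by (simp add: field_simps power2_eq_square)
      from this[OF pos] show ?thesis .
    qed
    finally show ?thesis
      using pos by (intro power2_le_imp_le[of ?H]) auto
  qed
  have "?H \<le> (?F + ?G) + e" if "e > 0" for e
    using le2[of "e / 2"] that by simp
  then show "?H \<le> ?F + ?G" by (rule field_le_epsilon)
qed

lemma hardy2_norm_sq_cong:
  assumes "\<And>w. w \<in> \<complex>\<^sub>+ \<Longrightarrow> cmod (f w) = cmod (g w)"
  shows "hardy2_norm_sq f = hardy2_norm_sq g"
  unfolding hardy2_norm_sq_def using assms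
  by (intro SUP_cong refl) (simp add: right_half_plane_def)

lemma hardy2_diff_finite:
  assumes "f \<in> hardy2" "g \<in> hardy2"
  shows "hardy2_norm_sq (\<lambda>w. f w - g w) < \<infinity>"
proof -
  have "hardy2_norm_sq (\<lambda>w. - g w) = hardy2_norm_sq g"
    by (rule hardy2_norm_sq_cong) simp
  then show ?thesis
    using hardy2_norm_add(1)[of f "\<lambda>w. - g w"] assms
    by (auto simp: hardy2_def intro: holomorphic_intros)
qed

lemma Metric_space_hardy2: "Metric_space hardy2 hardy2_dist"
proof
  show "0 \<le> hardy2_dist f g" for f g
    by (simp add: hardy2_dist_def hardy2_norm_nonneg)
  show "hardy2_dist f g = hardy2_dist g f" for f g
    unfolding hardy2_dist_def hardy2_norm_def
    by (subst hardy2_norm_sq_cong[of _ "\<lambda>w. g w - f w"]) (auto simp: norm_minus_commute)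
  show "hardy2_dist f h \<le> hardy2_dist f g + hardy2_dist g h"
    if "f \<in> hardy2" "g \<in> hardy2" "h \<in> hardy2" for f g h
    using hardy2_norm_add(2)[of "\<lambda>w. f w - g w" "\<lambda>w. g w - h w"] that
      hardy2_diff_finite[OF that(1,2)] hardy2_diff_finite[OF that(2,3)]
    by (auto simp: hardy2_dist_def hardy2_def intro: holomorphic_intros)
  show "hardy2_dist f g = 0 \<longleftrightarrow> f = g" if "f \<in> hardy2" "g \<in> hardy2" for f g
  proof
    assume "f = g"
    then show "hardy2_dist f g = 0"
      by (simp add: hardy2_dist_def hardy2_norm_def hardy2_norm_sq_def)
  next
    assume 0: "hardy2_dist f g = 0"
    let ?d = "\<lambda>w. f w - g w"
    have hol: "?d holomorphic_on \<complex>\<^sub>+"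
      using that by (auto simp: hardy2_def intro: holomorphic_intros)
    have sq0: "hardy2_norm_sq ?d = 0"
      using hardy2_norm_sq_eq[OF hardy2_diff_finite[OF that]] 0 by (simp add: hardy2_dist_def)
    have "f w = g w" if w: "w \<in> \<complex>\<^sub>+" for w
    proof -
      have x: "Re w > 0" using w by (simp add: right_half_plane_def)
      note [measurable] = hardy2_line_measurable(2)[OF hol x]
      have "(\<integral>\<^sup>+ y. ennreal ((cmod (?d (Complex (Re w) y)))\<^sup>2) \<partial>lborel) = 0"
        using hardy2_line_le[OF x, of ?d] sq0 by simp
      then have ae: "AE y in lborel. ?d (Complex (Re w) y) = 0"
        by (subst (asm) nn_integral_0_iff_AE) auto
      have "closed {y. ?d (Complex (Re w) y) = 0}"
        using hardy2_line_measurable(1)[OF hol x] by (intro closed_Collect_eq) auto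
      then have "Im w \<in> {y. ?d (Complex (Re w) y) = 0}"
        by (rule mem_closed_if_AE_lebesgue) (use AE_completion[OF ae] in simp)
      then show ?thesis by simp
    qed
    then show "f = g"
      using that by (intro extensionalityI[of f "\<complex>\<^sub>+" g]) (auto simp: hardy2_def)
  qed
qed

interpretation hardy2: Metric_space hardy2 hardy2_dist
  by (rule Metric_space_hardy2)

lemma topspace_hardy2_topology: "topspace hardy2_topology = hardy2"
  by (simp add: hardy2_topology_def)

lemma composition_operator_affine_hardy2:
  fixes a :: real and b :: complex
  assumes a: "a > 0" and b: "Re b \<ge> 0" and f: "f \<in> hardy2"
  shows "composition_operator (\<lambda>w. of_real a * w + b) f \<in> hardy2"
proof -
  let ?\<phi> = "\<lambda>w. of_real a * w + b"
  let ?C = "composition_operator ?\<phi> f"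
  have maps: "?\<phi> ` \<complex>\<^sub>+ \<subseteq> \<complex>\<^sub>+"
    using a b by (auto simp: right_half_plane_def add_pos_nonneg)
  have fh: "f holomorphic_on \<complex>\<^sub>+" using f by (simp add: hardy2_def)
  have "(f \<circ> ?\<phi>) holomorphic_on \<complex>\<^sub>+"
    by (rule holomorphic_on_compose_gen[OF _ fh maps]) (intro holomorphic_intros)
  then have hol: "?C holomorphic_on \<complex>\<^sub>+"
    by (rule holomorphic_transform) (simp add: composition_operator_def)
  have "hardy2_norm_sq ?C \<le> ennreal (1 / a) * hardy2_norm_sq f"
    unfolding hardy2_norm_sq_def[of ?C]
  proof (rule SUP_least)
    fix x :: real assume "x \<in> {0<..}"
    then have x: "x > 0" by simp
    let ?x = "a * x + Re b"
    have x': "?x > 0" using a b x by (simp add: add_pos_nonneg)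
    note [measurable] = hardy2_line_measurable(2)[OF fh x']
    let ?h = "\<lambda>y. ennreal ((cmod (f (Complex ?x y)))\<^sup>2)"
    have "(\<integral>\<^sup>+ y. ennreal ((cmod (?C (Complex x y)))\<^sup>2) \<partial>lborel) = (\<integral>\<^sup>+ y. ?h (Im b + a * y) \<partial>lborel)"
    proof (rule nn_integral_cong)
      fix y
      have "?\<phi> (Complex x y) = Complex ?x (Im b + a * y)" by (simp add: complex_eq_iff)
      then show "ennreal ((cmod (?C (Complex x y)))\<^sup>2) = ?h (Im b + a * y)"
        using x by (simp add: composition_operator_def right_half_plane_def)
    qed
    also have "\<dots> = ennreal (1 / a) * (\<integral>\<^sup>+ y. ?h y \<partial>lborel)"
    proof -
      have "(\<integral>\<^sup>+ y. ?h y \<partial>lborel) = ennreal \<bar>a\<bar> * (\<integral>\<^sup>+ y. ?h (Im b + a * y) \<partial>lborel)"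
        using a by (intro nn_integral_real_affine) auto
      then show ?thesis
        using a by (simp add: mult.assoc[symmetric] flip: ennreal_mult)
    qed
    also have "\<dots> \<le> ennreal (1 / a) * hardy2_norm_sq f"
      by (intro mult_left_mono hardy2_line_le x') auto
    finally show "(\<integral>\<^sup>+ y. ennreal ((cmod (?C (Complex x y)))\<^sup>2) \<partial>lborel)
      \<le> ennreal (1 / a) * hardy2_norm_sq f" .
  qed
  also have "\<dots> < \<infinity>"
    using f by (simp add: hardy2_def ennreal_mult_less_top)
  finally show ?thesis
    using hol by (simp add: hardy2_def composition_operator_def)
qed

end

theory Submission
  imports Defs "HOL-Probability.Sinc_Integral"
begin

text \<open>
  Let \<open>q\<^sub>S f\<close> be the supremum of the squared \<open>L\<^sup>2\<close> norms of \<open>f\<close> on the vertical lines with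
  abscissa in a set \<open>S\<close> of positive reals. It is dominated by the squared Hardy norm, and up to a
  factor \<open>2\<close> it satisfies the triangle inequality. Hence along a dense orbit the values of \<open>q\<^sub>S\<close>
  must become arbitrarily large as well as arbitrarily small.

  This is impossible, because \<open>q\<^sub>S\<close> moves in one direction only along an orbit of
  \<open>C\<^sub>\<phi>\<close>, if \<open>S\<close> is chosen well. The map \<open>\<phi>\<close> sends the line \<open>Re w = x\<close> affinely, with dilation
  factor \<open>a\<close>, onto the line \<open>Re w = a x + Re b\<close>, so the change of variables in \<open>y\<close> gives
  \<open>q\<^sub>S (C\<^sub>\<phi> f) = q\<^bsub>aS + Re b\<^esub> f / a\<close> (lemma \<open>sup_energy_composition_affine\<close>).

  If \<open>a \<ge> 1\<close>, take all positive abscissas: \<open>C\<^sub>\<phi>\<close> is a contraction and orbits stay bounded.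

  If \<open>a < 1\<close>, the map \<open>x \<mapsto> a x + Re b\<close> has the fixed point \<open>x\<^sub>0 = Re b / (1 - a) \<ge> 0\<close>, and it maps
  the half-line \<open>S = {x\<^sub>0<..}\<close> onto itself. So \<open>C\<^sub>\<phi>\<close> multiplies \<open>q\<^sub>S\<close> by \<open>1 / a > 1\<close>: an orbit on which
  \<open>q\<^sub>S\<close> is positive stays away from \<open>0\<close>, and one on which it vanishes cannot approach functions with
  \<open>q\<^sub>S > 0\<close>. In this way an interior fixed point of \<open>\<phi>\<close> and one on the boundary are treated
  alike.
\<close>

section \<open>Energy on vertical lines\<close>

definition line_energy :: "real \<Rightarrow> (complex \<Rightarrow> complex) \<Rightarrow> ennreal"
  where "line_energy x f = (\<integral>\<^sup>+ y. ennreal ((cmod (f (Complex x y)))\<^sup>2) \<partial>lborel)"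

definition sup_energy :: "real set \<Rightarrow> (complex \<Rightarrow> complex) \<Rightarrow> ennreal"
  where "sup_energy S f = (SUP x\<in>S. line_energy x f)"

lemma sup_energy_mono: "S \<subseteq> T \<Longrightarrow> sup_energy S f \<le> sup_energy T f"
  unfolding sup_energy_def by (rule SUP_subset_mono) auto

lemma hardy2_norm_sq_eq_sup_energy: "hardy2_norm_sq f = sup_energy {0<..} f"
  by (simp add: hardy2_norm_sq_def sup_energy_def line_energy_def)

lemma sup_energy_le_hardy2_norm_sq: "S \<subseteq> {0<..} \<Longrightarrow> sup_energy S f \<le> hardy2_norm_sq f"
  unfolding hardy2_norm_sq_eq_sup_energy by (rule sup_energy_mono)

lemma line_energy_scale:
  assumes "f holomorphic_on \<complex>\<^sub>+" "x > 0"
  shows "line_energy x (\<lambda>w. c * f w) = ennreal ((cmod c)\<^sup>2) * line_energy x f"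
proof -
  note [measurable] = hardy2_line_measurable(2)[OF assms]
  show ?thesis
    unfolding line_energy_def
    by (subst nn_integral_cmult[symmetric]) (auto simp: norm_mult power_mult_distrib ennreal_mult)
qed

lemma sup_energy_scale:
  assumes "f holomorphic_on \<complex>\<^sub>+" "S \<subseteq> {0<..}"
  shows "sup_energy S (\<lambda>w. c * f w) = ennreal ((cmod c)\<^sup>2) * sup_energy S f"
  unfolding sup_energy_def SUP_mult_left_ennreal
  using assms by (intro SUP_cong refl line_energy_scale) auto

lemma sup_energy_cong:
  assumes "S \<subseteq> {0<..}" "\<And>w. w \<in> \<complex>\<^sub>+ \<Longrightarrow> f w = g w"
  shows "sup_energy S f = sup_energy S g"
  unfolding sup_energy_def line_energy_def using assms
  by (intro SUP_cong refl nn_integral_cong) (auto simp: right_half_plane_def)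

text \<open>The squared triangle inequality \<open>|u|\<^sup>2 \<le> 2 |u - v|\<^sup>2 + 2 |v|\<^sup>2\<close>, integrated. The crude factor
  \<open>2\<close> is harmless where only large and small values of the energy matter, and it allows
  working in \<^typ>\<open>ennreal\<close> without square roots.\<close>

lemma sup_energy_le_diff:
  assumes f: "f holomorphic_on \<complex>\<^sub>+" and g: "g holomorphic_on \<complex>\<^sub>+" and S: "S \<subseteq> {0<..}"
  shows "sup_energy S f \<le> 2 * hardy2_norm_sq (\<lambda>w. f w - g w) + 2 * sup_energy S g"
  unfolding sup_energy_def[of S f]
proof (rule SUP_least)
  fix x assume xS: "x \<in> S"
  with S have x: "x > 0" by auto
  note [measurable] = hardy2_line_measurable(2)[OF f x] hardy2_line_measurable(2)[OF g x]
  have pw: "ennreal ((cmod u)\<^sup>2) \<le> 2 * ennreal ((cmod (u - v))\<^sup>2) + 2 * ennreal ((cmod v)\<^sup>2)" for u v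
  proof -
    have "(cmod u)\<^sup>2 \<le> (cmod (u - v) + cmod v)\<^sup>2"
      using norm_triangle_ineq[of "u - v" v] by (intro power_mono) auto
    also have "\<dots> \<le> 2 * (cmod (u - v))\<^sup>2 + 2 * (cmod v)\<^sup>2"
      using sum_squares_bound[of "cmod (u - v)" "cmod v"] by (simp add: power2_sum)
    finally have "ennreal ((cmod u)\<^sup>2) \<le> ennreal (2 * (cmod (u - v))\<^sup>2 + 2 * (cmod v)\<^sup>2)"
      by (rule ennreal_leI)
    then show ?thesis by (simp add: ennreal_plus ennreal_mult)
  qed
  have "line_energy x f \<le>
      (\<integral>\<^sup>+ y. 2 * ennreal ((cmod (f (Complex x y) - g (Complex x y)))\<^sup>2)
        + 2 * ennreal ((cmod (g (Complex x y)))\<^sup>2) \<partial>lborel)"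
    unfolding line_energy_def by (intro nn_integral_mono pw)
  also have "\<dots> = 2 * line_energy x (\<lambda>w. f w - g w) + 2 * line_energy x g"
    by (simp add: line_energy_def nn_integral_add nn_integral_cmult)
  also have "\<dots> \<le> 2 * hardy2_norm_sq (\<lambda>w. f w - g w) + 2 * sup_energy S g"
    unfolding hardy2_norm_sq_eq_sup_energy sup_energy_def using xS x
    by (intro add_mono mult_left_mono SUP_upper) auto
  finally show "line_energy x f \<le> 2 * hardy2_norm_sq (\<lambda>w. f w - g w) + 2 * sup_energy S g" .
qed

section \<open>Energy under affine composition\<close>

text \<open>On the line \<open>Re w = x\<close> the composition with \<open>\<phi>\<close> is the real substitution
  \<open>y \<mapsto> a y + Im b\<close> on the line \<open>Re w = a x + Re b\<close>; its Jacobian gives the factor.\<close>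

lemma line_energy_composition_affine:
  fixes a x :: real and b :: complex
  assumes f: "f holomorphic_on \<complex>\<^sub>+" and a: "a > 0" and b: "Re b \<ge> 0" and x: "x > 0"
  shows "line_energy x (composition_operator (\<lambda>w. of_real a * w + b) f)
    = ennreal (1 / a) * line_energy (a * x + Re b) f"
proof -
  let ?x = "a * x + Re b"
  have x': "?x > 0" using a b x by (simp add: add_pos_nonneg)
  note [measurable] = hardy2_line_measurable(2)[OF f x']
  let ?h = "\<lambda>y. ennreal ((cmod (f (Complex ?x y)))\<^sup>2)"
  have "of_real a * Complex x y + b = Complex ?x (Im b + a * y)" for y
    by (simp add: complex_eq_iff)
  then have "line_energy x (composition_operator (\<lambda>w. of_real a * w + b) f)
      = (\<integral>\<^sup>+ y. ?h (Im b + a * y) \<partial>lborel)"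
    using x by (simp add: line_energy_def composition_operator_def right_half_plane_def)
  moreover have "(\<integral>\<^sup>+ y. ?h y \<partial>lborel) = ennreal \<bar>a\<bar> * (\<integral>\<^sup>+ y. ?h (Im b + a * y) \<partial>lborel)"
    using a by (intro nn_integral_real_affine) auto
  ultimately show ?thesis
    using a by (simp add: line_energy_def mult.assoc[symmetric] flip: ennreal_mult)
qed

lemma sup_energy_composition_affine:
  fixes a :: real and b :: complex
  assumes "f holomorphic_on \<complex>\<^sub>+" "a > 0" "Re b \<ge> 0" "S \<subseteq> {0<..}"
  shows "sup_energy S (composition_operator (\<lambda>w. of_real a * w + b) f)
    = ennreal (1 / a) * sup_energy ((\<lambda>x. a * x + Re b) ` S) f"
  unfolding sup_energy_def SUP_mult_left_ennreal image_image
  using assms by (intro SUP_cong refl line_energy_composition_affine) auto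

section \<open>Functions of large energy\<close>

text \<open>On every line of the half-plane, \<open>|w + 1|\<^sup>2 \<ge> 1 + y\<^sup>2\<close>, and \<open>1 / (1 + y\<^sup>2)\<close> is
  integrable. The constant \<open>c\<close> makes the zero function and all multiples available as well.\<close>

lemma cauchy_kernel_hardy2:
  fixes c :: complex
  defines "k \<equiv> restrict (\<lambda>w. c / (w + 1)) \<complex>\<^sub>+"
  shows "k \<in> hardy2"
proof -
  have "(\<lambda>w. c / (w + 1)) holomorphic_on \<complex>\<^sub>+"
    by (intro holomorphic_intros) (auto simp: right_half_plane_def complex_eq_iff)
  then have hol: "k holomorphic_on \<complex>\<^sub>+"
    by (rule holomorphic_transform) (simp add: k_def)
  let ?h = "\<lambda>y. inverse (1 + y\<^sup>2) :: real"
  have "integrable lborel ?h"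
    using integrable_inverse_1_plus_square by (simp add: set_integrable_def)
  then have fin: "(\<integral>\<^sup>+ y. ennreal (?h y) \<partial>lborel) < \<infinity>"
    by (simp add: integrable_iff_bounded)
  have "hardy2_norm_sq k \<le> ennreal ((cmod c)\<^sup>2) * (\<integral>\<^sup>+ y. ennreal (?h y) \<partial>lborel)"
    unfolding hardy2_norm_sq_def
  proof (rule SUP_least)
    fix x :: real assume "x \<in> {0<..}"
    then have x: "x > 0" by simp
    have "(cmod (k (Complex x y)))\<^sup>2 \<le> (cmod c)\<^sup>2 * ?h y" for y
    proof -
      have "1 + y\<^sup>2 \<le> (cmod (Complex x y + 1))\<^sup>2"
        using x by (simp add: cmod_power2 one_le_power)
      moreover have "0 < 1 + y\<^sup>2" by (simp add: add_pos_nonneg)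
      ultimately have "(cmod c)\<^sup>2 / (cmod (Complex x y + 1))\<^sup>2 \<le> (cmod c)\<^sup>2 / (1 + y\<^sup>2)"
        by (intro divide_left_mono mult_pos_pos) auto
      then show ?thesis
        using x by (simp add: k_def right_half_plane_def norm_divide power_divide flip: divide_inverse)
    qed
    then have "(\<integral>\<^sup>+ y. ennreal ((cmod (k (Complex x y)))\<^sup>2) \<partial>lborel)
        \<le> (\<integral>\<^sup>+ y. ennreal ((cmod c)\<^sup>2) * ennreal (?h y) \<partial>lborel)"
      by (intro nn_integral_mono) (simp flip: ennreal_mult')
    then show "(\<integral>\<^sup>+ y. ennreal ((cmod (k (Complex x y)))\<^sup>2) \<partial>lborel)
        \<le> ennreal ((cmod c)\<^sup>2) * (\<integral>\<^sup>+ y. ennreal (?h y) \<partial>lborel)"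
      by (simp add: nn_integral_cmult)
  qed
  also have "\<dots> < \<infinity>"
    using fin by (simp add: ennreal_mult_less_top)
  finally show ?thesis
    using hol by (simp add: hardy2_def k_def)
qed

text \<open>The kernel \<open>1 / (w + 1)\<close> has no zero, so its energy on any line is positive, and multiples of
  it have arbitrarily large energy.\<close>

lemma sup_energy_unbounded:
  assumes S: "S \<subseteq> {0<..}" "S \<noteq> {}" and K: "K < \<infinity>"
  obtains g where "g \<in> hardy2" "K < sup_energy S g"
proof -
  let ?k = "\<lambda>c. restrict (\<lambda>w. c / (w + 1)) \<complex>\<^sub>+"
  have k: "?k c \<in> hardy2" for c by (rule cauchy_kernel_hardy2)
  then have hol: "?k c holomorphic_on \<complex>\<^sub>+" for c by (simp add: hardy2_def)
  obtain x where xS: "x \<in> S" and x: "x > 0" using S by blast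
  note [measurable] = hardy2_line_measurable(2)[OF hol x]
  have "Complex x y + 1 \<noteq> 0" for y
    using x by (simp add: complex_eq_iff)
  then have nz: "?k 1 (Complex x y) \<noteq> 0" for y
    using x by (simp add: right_half_plane_def)
  have m: "(\<lambda>y. ennreal ((cmod (?k 1 (Complex x y)))\<^sup>2)) \<in> borel_measurable lborel"
    by measurable
  have "line_energy x (?k 1) \<noteq> 0"
  proof
    assume "line_energy x (?k 1) = 0"
    then have "AE y in lborel. ?k 1 (Complex x y) = 0"
      unfolding line_energy_def nn_integral_0_iff_AE[OF m] by (simp del: restrict_apply)
    then have "AE y in (lborel :: real measure). False"
      using nz by (simp del: restrict_apply)
    then show False
      by (simp flip: trivial_limit_def add: ae_filter_eq_bot_iff)
  qed
  then have pos: "0 < line_energy x (?k 1)" by (simp add: zero_less_iff_neq_zero)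
  also have "\<dots> \<le> sup_energy S (?k 1)"
    unfolding sup_energy_def by (rule SUP_upper[OF xS])
  finally have pos: "0 < sup_energy S (?k 1)" .
  have "sup_energy S (?k 1) < \<infinity>"
    using sup_energy_le_hardy2_norm_sq[OF S(1), of "?k 1"] k[of 1]
    by (auto simp: hardy2_def intro: le_less_trans)
  then obtain r where r: "sup_energy S (?k 1) = ennreal r" "r > 0"
    using pos by (cases "sup_energy S (?k 1)") auto
  obtain K' where K': "K = ennreal K'" "K' \<ge> 0"
    using K by (cases K) auto
  \<comment> \<open>chosen so that the multiple by \<open>c\<close> has energy \<open>K' + 1\<close>\<close>
  define c where "c = sqrt ((K' + 1) / r)"
  have "sup_energy S (?k (of_real c)) = sup_energy S (\<lambda>w. of_real c * ?k 1 w)"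
    using S(1) by (rule sup_energy_cong) simp
  also have "\<dots> = ennreal (c\<^sup>2) * ennreal r"
    using sup_energy_scale[OF hol S(1)] r(1) by simp
  also have "\<dots> = ennreal (K' + 1)"
    using r(2) K'(2) by (simp add: c_def flip: ennreal_mult)
  finally have "K < sup_energy S (?k (of_real c))"
    using K' by (simp add: ennreal_less_iff)
  with k show ?thesis by (rule that)
qed

section \<open>Energy along dense orbits\<close>

text \<open>A dense orbit comes so near to \<open>g\<close> that the two energies are comparable. With \<open>g\<close> of large
  energy the first inequality forces large energies in the orbit, with \<open>g = 0\<close> the second one
  forces small energies.\<close>

lemma dense_orbit_energy:
  assumes T: "\<And>f. f \<in> hardy2 \<Longrightarrow> T f \<in> hardy2" and f: "f \<in> hardy2"
    and dense: "hardy2_topology closure_of range (\<lambda>n. (T ^^ n) f) = hardy2"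
    and S: "S \<subseteq> {0<..}" and g: "g \<in> hardy2" and e: "e > 0"
  obtains n where "sup_energy S g \<le> ennreal e + 2 * sup_energy S ((T ^^ n) f)"
    and "sup_energy S ((T ^^ n) f) \<le> ennreal e + 2 * sup_energy S g"
proof -
  have orbit: "(T ^^ n) f \<in> hardy2" for n
    by (induction n) (auto intro: T f)
  have closure: "g \<in> hardy2.mtopology closure_of range (\<lambda>n. (T ^^ n) f)"
    using dense g by (simp add: hardy2_topology_def)
  then obtain n where n: "hardy2_dist g ((T ^^ n) f) < sqrt (e / 2)"
  proof -
    have "0 < sqrt (e / 2)" using e by simp
    with closure have "\<exists>h\<in>range (\<lambda>n. (T ^^ n) f). h \<in> hardy2.mball g (sqrt (e / 2))"
      unfolding hardy2.metric_closure_of by blast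
    then show ?thesis using that by auto
  qed
  have close: "2 * hardy2_norm_sq (\<lambda>w. u w - v w) \<le> ennreal e"
    if "u \<in> hardy2" "v \<in> hardy2" "hardy2_dist u v < sqrt (e / 2)" for u v
  proof -
    have "(hardy2_dist u v)\<^sup>2 \<le> (sqrt (e / 2))\<^sup>2"
      using that(3) by (intro power_mono) auto
    then have "2 * (hardy2_dist u v)\<^sup>2 \<le> e" using e by simp
    then have "ennreal (2 * (hardy2_dist u v)\<^sup>2) \<le> ennreal e" by (rule ennreal_leI)
    then show ?thesis
      using hardy2_norm_sq_eq[OF hardy2_diff_finite[OF that(1,2)]]
      by (simp add: hardy2_dist_def ennreal_mult)
  qed
  have bound: "sup_energy S u \<le> ennreal e + 2 * sup_energy S v"
    if "u \<in> hardy2" "v \<in> hardy2" "hardy2_dist u v < sqrt (e / 2)" for u v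
  proof -
    have "sup_energy S u \<le> 2 * hardy2_norm_sq (\<lambda>w. u w - v w) + 2 * sup_energy S v"
      using that S by (intro sup_energy_le_diff) (auto simp: hardy2_def)
    also have "\<dots> \<le> ennreal e + 2 * sup_energy S v"
      by (intro add_right_mono close that)
    finally show ?thesis .
  qed
  show ?thesis
    using bound[OF g orbit n] bound[OF orbit g] n by (intro that[of n]) (auto simp: hardy2.commute)
qed

text \<open>The orbit of \<open>f\<close> has energy at most that of \<open>f\<close>, so it stays away from functions of
  much larger energy.\<close>

lemma not_hypercyclic_if_energy_nonincreasing:
  assumes T: "\<And>f. f \<in> hardy2 \<Longrightarrow> T f \<in> hardy2" and S: "S \<subseteq> {0<..}" "S \<noteq> {}"
    and le: "\<And>f. f \<in> hardy2 \<Longrightarrow> sup_energy S (T f) \<le> sup_energy S f"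
  shows "\<not> hypercyclic hardy2_topology T"
proof
  assume "hypercyclic hardy2_topology T"
  then obtain f where f: "f \<in> hardy2"
    and dense: "hardy2_topology closure_of range (\<lambda>n. (T ^^ n) f) = hardy2"
    by (auto simp: hypercyclic_def topspace_hardy2_topology)
  have orbit: "(T ^^ n) f \<in> hardy2" for n
    by (induction n) (auto intro: T f)
  have bounded: "sup_energy S ((T ^^ n) f) \<le> sup_energy S f" for n
    by (induction n) (auto intro: order_trans[OF le[OF orbit]])
  have "sup_energy S f < \<infinity>"
    using sup_energy_le_hardy2_norm_sq[OF S(1), of f] f
    by (auto simp: hardy2_def intro: le_less_trans)
  then have "ennreal 1 + 2 * sup_energy S f < \<infinity>"
    by (simp add: ennreal_mult_less_top)
  then obtain g where g: "g \<in> hardy2" "ennreal 1 + 2 * sup_energy S f < sup_energy S g"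
    using sup_energy_unbounded[OF S] by blast
  obtain n where "sup_energy S g \<le> ennreal 1 + 2 * sup_energy S ((T ^^ n) f)"
    using dense_orbit_energy[OF T f dense S(1) g(1) zero_less_one] by blast
  also have "\<dots> \<le> ennreal 1 + 2 * sup_energy S f"
    by (intro add_left_mono mult_left_mono bounded) auto
  finally show False using g(2) by simp
qed

text \<open>Exact scaling, and not only growth, is what settles functions of energy \<open>0\<close>: their orbits
  remain in the kernel of the energy.\<close>

lemma not_hypercyclic_if_energy_expanding:
  assumes T: "\<And>f. f \<in> hardy2 \<Longrightarrow> T f \<in> hardy2" and S: "S \<subseteq> {0<..}" "S \<noteq> {}"
    and c: "1 \<le> c" and eq: "\<And>f. f \<in> hardy2 \<Longrightarrow> sup_energy S (T f) = c * sup_energy S f"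
  shows "\<not> hypercyclic hardy2_topology T"
proof
  assume "hypercyclic hardy2_topology T"
  then obtain f where f: "f \<in> hardy2"
    and dense: "hardy2_topology closure_of range (\<lambda>n. (T ^^ n) f) = hardy2"
    by (auto simp: hypercyclic_def topspace_hardy2_topology)
  have orbit: "(T ^^ n) f \<in> hardy2" for n
    by (induction n) (auto intro: T f)
  have energy: "sup_energy S ((T ^^ n) f) = c ^ n * sup_energy S f" for n
    by (induction n) (auto simp: eq[OF orbit] mult.assoc)
  show False
  proof (cases "sup_energy S f = 0")
    case True
    \<comment> \<open>Now the energy vanishes on the whole orbit, so the orbit cannot approach
      a function of energy greater than \<open>1\<close>.\<close>
    obtain g where g: "g \<in> hardy2" "1 < sup_energy S g"
      using sup_energy_unbounded[OF S, of 1] by auto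
    obtain n where "sup_energy S g \<le> ennreal 1 + 2 * sup_energy S ((T ^^ n) f)"
      using dense_orbit_energy[OF T f dense S(1) g(1) zero_less_one] by blast
    then show False using g(2) True energy by simp
  next
    case False
    \<comment> \<open>Now the energy along the orbit is at least that of \<open>f\<close>, so the orbit cannot approach \<open>0\<close>.\<close>
    let ?z = "restrict (\<lambda>_. 0) \<complex>\<^sub>+ :: complex \<Rightarrow> complex"
    have z: "?z \<in> hardy2" using cauchy_kernel_hardy2[of 0] by simp
    have z0: "sup_energy S ?z = 0"
      using sup_energy_cong[OF S(1), of ?z "\<lambda>_. 0"] by (simp add: sup_energy_def line_energy_def S(2))
    obtain d where d: "0 < d" "d < sup_energy S f"
      using False Orderings.dense[of 0 "sup_energy S f"] by (auto simp: zero_less_iff_neq_zero)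
    then obtain e where e: "0 < e" "ennreal e < sup_energy S f"
      by (cases d) auto
    obtain n where "sup_energy S ((T ^^ n) f) \<le> ennreal e + 2 * sup_energy S ?z"
      using dense_orbit_energy[OF T f dense S(1) z e(1)] by blast
    then have "sup_energy S ((T ^^ n) f) < sup_energy S f"
      using e(2) z0 by simp
    moreover have "1 * sup_energy S f \<le> sup_energy S ((T ^^ n) f)"
      unfolding energy using c by (intro mult_right_mono one_le_power) auto
    ultimately show False by simp
  qed
qed

section \<open>Affine composition operators are not hypercyclic\<close>

theorem theorem10:
  fixes a :: real and b :: complex
  assumes "a > 0" and "Re b \<ge> 0"
  shows "\<not> hypercyclic hardy2_topology (composition_operator (\<lambda>w. of_real a * w + b))"
    (is "\<not> hypercyclic _ ?C")
proof (cases "1 \<le> a")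
  case True
  show ?thesis
  proof (rule not_hypercyclic_if_energy_nonincreasing[where S = "{0<..}"])
    fix f assume f: "f \<in> hardy2"
    show "?C f \<in> hardy2" by (rule composition_operator_affine_hardy2[OF assms f])
    have "sup_energy {0<..} (?C f) = ennreal (1 / a) * sup_energy ((\<lambda>x. a * x + Re b) ` {0<..}) f"
      using f assms by (intro sup_energy_composition_affine) (auto simp: hardy2_def)
    also have "\<dots> \<le> 1 * sup_energy {0<..} f"
      using True assms
      by (intro mult_mono sup_energy_mono) (auto simp: add_pos_nonneg simp flip: ennreal_1 intro!: ennreal_leI)
    finally show "sup_energy {0<..} (?C f) \<le> sup_energy {0<..} f" by simp
  qed auto
next
  case False
  define x0 where "x0 = Re b / (1 - a)"
  have fixp: "Re b = (1 - a) * x0" and x0: "x0 \<ge> 0"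
    using False assms by (auto simp: x0_def)
  have inv: "(\<lambda>x. a * x + Re b) ` {x0<..} = {x0<..}"
  proof (intro equalityI subsetI)
    fix x assume "x \<in> (\<lambda>x. a * x + Re b) ` {x0<..}"
    then show "x \<in> {x0<..}" using assms(1) by (auto simp: fixp algebra_simps)
  next
    fix x assume "x \<in> {x0<..}"
    then have "x0 + (x - x0) / a \<in> {x0<..}" "x = a * (x0 + (x - x0) / a) + Re b"
      using assms(1) by (auto simp: fixp field_simps)
    then show "x \<in> (\<lambda>x. a * x + Re b) ` {x0<..}" by blast
  qed
  show ?thesis
  proof (rule not_hypercyclic_if_energy_expanding[where S = "{x0<..}" and c = "ennreal (1 / a)"])
    fix f assume f: "f \<in> hardy2"
    show "?C f \<in> hardy2" by (rule composition_operator_affine_hardy2[OF assms f])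
    show "sup_energy {x0<..} (?C f) = ennreal (1 / a) * sup_energy {x0<..} f"
      using f assms x0 sup_energy_composition_affine[of f a b "{x0<..}"] by (auto simp: hardy2_def inv)
  next
    show "1 \<le> ennreal (1 / a)"
      using False assms by (auto simp flip: ennreal_1 intro!: ennreal_leI)
  qed (use x0 in auto)
qed

end
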